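(* Let $a(n)$ be the number of perfect matchings of $\{1,\dots,2n\}$ with no even-to-odd matches (with $a(0)=1$). Then for all $n\ge1$, \[a(n)=a(n-1)+\sum_{i=1}^{n-1}a(i)\binom{n-1}{i-1}.\]
   Context: A perfect matching of $\{1,\dots,2n\}$ is a partition of it into 2-element subsets (matches). An even-to-odd match is a match consisting of an even number and a larger odd number. *)

theory Defs
  imports Main "HOL-Library.Disjoint_Sets"
begin

definition perfect_matching :: "nat \<Rightarrow> nat set set \<Rightarrow> bool" where
  "perfect_matching n M \<longleftrightarrow> partition_on {1..2 * n} M \<and> (\<forall>e\<in>M. card e = 2)"

definition even_to_odd :: "nat set \<Rightarrow> bool" where
  "even_to_odd e \<longleftrightarrow> (\<exists>i j. e = {i, j} \<and> even i \<and> odd j \<and> i < j)"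

definition a :: "nat \<Rightarrow> nat" where
  "a n = card {M. perfect_matching n M \<and> \<not> (\<exists>e\<in>M. even_to_odd e)}"

text \<open>
  The convention \<open>a 0 = 1\<close> needs no separate clause: the empty partition is the only partition of
  the empty set.
\<close>

lemma a_0: "a 0 = 1"
proof -
  have "{M. perfect_matching 0 M \<and> \<not> (\<exists>e\<in>M. even_to_odd e)} = {{}}"
    by (auto simp: perfect_matching_def partition_on_empty)
  then show ?thesis by (simp add: a_def)
qed

end

theory Submission
  imports Defs
begin

text \<open>
  In a matching without even-to-odd matches, every match is either between two odd numbers, between
  two even numbers, or a pair \<open>{i, j}\<close> with \<open>i\<close> odd, \<open>j\<close> even and \<open>i < j\<close>. The pairs of the last kind form
  a set \<open>P\<close> of disjoint edges, that is, a placement of non-attacking rooks on a staircase board. If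
  \<open>m = n - card P\<close>, then \<open>m\<close> odd and \<open>m\<close> even numbers remain, and each of the two sets may be matched
  internally without any restriction. Hence \<open>a n\<close> is the sum of \<open>c m\<close> over all placements, where \<open>c m\<close>
  is the square of the number of perfect matchings of an \<open>m\<close>-element set
  (\<open>a_eq_placement_sum\<close>).

  More generally let \<open>W n g\<close> be the sum of \<open>g (n - card P)\<close> over the placements \<open>P\<close>. The number of
  placements with \<open>n - card P = m\<close> is the Stirling number of the second kind \<open>S (n + 1, m + 1)\<close>, so with
  \<open>u = exp x - 1\<close> the exponential generating function of \<open>W n g\<close> in \<open>n\<close> is \<open>exp x\<close> times the sum of
  \<open>g m * u ^ m / m!\<close>. For \<open>g = c\<close> it is a series \<open>A\<close> with \<open>(2 - exp x) * A' = A\<close>, and the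
  recurrence reads off the coefficients of \<open>2 * A' = A + exp x * A'\<close>.

  The proof carries out this calculation without power series, by working with the argument \<open>g\<close> of the
  linear functional \<open>W n\<close>. Differentiation becomes the operator \<open>extend\<close> (\<open>placement_sum_Suc\<close>, obtained
  by deciding what happens to the two new numbers \<open>2 * n + 1\<close> and \<open>2 * n + 2\<close>), and multiplication by
  \<open>exp x\<close>, which is the binomial transform, becomes \<open>binomial_adjoint\<close>
  (\<open>sum_binomial_placement_sum\<close>). The differential equation is then the pointwise
  identity \<open>weight_functional_equation\<close>, which rests on \<open>c (m + 1) = m\<^sup>2 * c (m - 1)\<close>.
\<close>

section \<open>Perfect matchings of a finite set\<close>

definition matchings :: "'a set \<Rightarrow> 'a set set set" where
  "matchings S = {M. partition_on S M \<and> (\<forall>e\<in>M. card e = 2)}"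

lemma finite_matchings: "finite S \<Longrightarrow> finite (matchings S)"
  by (rule finite_subset[of _ "Pow (Pow S)"]) (auto simp: matchings_def partition_on_def)

lemma matchings_empty: "matchings {} = {{}}"
  by (auto simp: matchings_def partition_on_empty)

text \<open>The union is over the partner \<open>y\<close> of the new element \<open>x\<close>.\<close>

lemma matchings_insert:
  assumes "x \<notin> S"
  shows "matchings (insert x S) = (\<Union>y\<in>S. insert {x, y} ` matchings (S - {y}))"
proof (intro equalityI subsetI)
  fix M assume "M \<in> matchings (insert x S)"
  then have p: "partition_on (insert x S) M" and c: "\<And>e. e \<in> M \<Longrightarrow> card e = 2"
    by (auto simp: matchings_def)
  from p obtain e where e: "e \<in> M" "x \<in> e"
    by (auto simp: partition_on_def)
  obtain u v where "e = {u, v}" "u \<noteq> v" using c[OF e(1)] by (meson card_2_iff)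
  with e(2) obtain y where y: "e = {x, y}" "x \<noteq> y" by blast
  have U: "\<Union>M = insert x S" using p by (simp add: partition_on_def)
  then have "e \<subseteq> insert x S" using e(1) by blast
  then have "y \<in> S" using y by blast
  have "disjoint M" using p by (simp add: partition_on_def)
  then have dj: "f \<inter> {x, y} = {}" if "f \<in> M - {e}" for f
    using that e y by (auto simp: disjoint_def)
  have "M - {e} \<in> matchings (S - {y})"
    unfolding matchings_def partition_on_def
  proof (intro CollectI conjI)
    show "\<Union> (M - {e}) = S - {y}"
    proof -
      have "\<Union> M = e \<union> \<Union> (M - {e})" using e(1) by blast
      then have "insert x S = insert x (insert y (\<Union> (M - {e})))" using U y(1) by simp
      moreover have "x \<notin> \<Union> (M - {e})" "y \<notin> \<Union> (M - {e})" using dj by blast+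
      ultimately show ?thesis using assms \<open>x \<noteq> y\<close> by (simp add: set_eq_iff) metis
    qed
    show "disjoint (M - {e})" using \<open>disjoint M\<close> by (auto simp: disjoint_def)
    show "{} \<notin> M - {e}" using p by (auto simp: partition_on_def)
    show "\<forall>e\<in>M - {e}. card e = 2" using c by auto
  qed
  moreover have "M = insert {x, y} (M - {e})" using e y by auto
  ultimately show "M \<in> (\<Union>y\<in>S. insert {x, y} ` matchings (S - {y}))"
    using \<open>y \<in> S\<close> by blast
next
  fix M assume "M \<in> (\<Union>y\<in>S. insert {x, y} ` matchings (S - {y}))"
  then obtain y N where y: "y \<in> S" and N: "N \<in> matchings (S - {y})" and M: "M = insert {x, y} N"
    by blast
  have "x \<noteq> y" using y assms by auto
  have U: "\<Union>N = S - {y}" using N by (auto simp: matchings_def partition_on_def)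
  have "\<Union>M = insert x S" using U M y by auto
  moreover have "disjoint M"
  proof -
    have "disjoint N" using N by (auto simp: matchings_def partition_on_def)
    moreover have "f \<inter> {x, y} = {}" if "f \<in> N" for f
      using U that assms by auto
    ultimately show ?thesis unfolding M by (fastforce simp: disjoint_def)
  qed
  ultimately show "M \<in> matchings (insert x S)"
    using N M \<open>x \<noteq> y\<close> by (auto simp: matchings_def partition_on_def)
qed

lemma card_matchings_insert:
  assumes "finite S" "x \<notin> S"
  shows "card (matchings (insert x S)) = (\<Sum>y\<in>S. card (matchings (S - {y})))"
proof -
  have new: "x \<notin> e" if "N \<in> matchings (S - {y})" "e \<in> N" for N e y
    using that assms(2) by (auto simp: matchings_def partition_on_def)
  have inj: "inj_on (insert {x, y}) (matchings (S - {y}))" for y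
  proof (rule inj_onI)
    fix M N
    assume M: "M \<in> matchings (S - {y})" and N: "N \<in> matchings (S - {y})"
      and eq: "insert {x, y} M = insert {x, y} N"
    have "{x, y} \<notin> M" "{x, y} \<notin> N" using new[OF M] new[OF N] by auto
    then show "M = N" using eq by (metis insert_ident)
  qed
  have "card (matchings (insert x S)) =
      (\<Sum>y\<in>S. card (insert {x, y} ` matchings (S - {y})))"
    unfolding matchings_insert[OF assms(2)]
  proof (rule card_UN_disjoint)
    show "\<forall>y\<in>S. \<forall>z\<in>S. y \<noteq> z \<longrightarrow>
        insert {x, y} ` matchings (S - {y}) \<inter> insert {x, z} ` matchings (S - {z}) = {}"
    proof (intro ballI impI)
      fix y z assume yz: "y \<in> S" "z \<in> S" "y \<noteq> z"
      have False if "M \<in> matchings (S - {y})" "N \<in> matchings (S - {z})"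
          "insert {x, y} M = insert {x, z} N" for M N
      proof -
        have "{x, y} \<noteq> {x, z}" using yz by (auto simp: doubleton_eq_iff)
        then have "{x, y} \<in> N" using that(3) by auto
        then show False using new[OF that(2)] by auto
      qed
      then show "insert {x, y} ` matchings (S - {y}) \<inter> insert {x, z} ` matchings (S - {z}) = {}"
        by blast
    qed
  qed (use assms finite_matchings in auto)
  also have "\<dots> = (\<Sum>y\<in>S. card (matchings (S - {y})))"
    by (simp add: card_image[OF inj])
  finally show ?thesis .
qed

lemma matchings_edge:
  assumes "M \<in> matchings S" "e \<in> M"
  shows "e \<noteq> {}" "e \<subseteq> S"
  using assms by (auto simp: matchings_def partition_on_def)

lemma matchings_Un:
  assumes "M \<in> matchings S" "N \<in> matchings T" "S \<inter> T = {}"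
  shows "M \<union> N \<in> matchings (S \<union> T)"
proof -
  have "\<Union>M \<inter> \<Union>N = {}" using assms by (simp add: matchings_def partition_on_def)
  then show ?thesis
    using assms by (auto simp: matchings_def partition_on_def intro!: disjoint_union)
qed

text \<open>
  If the remaining edges of a matching lie inside \<open>C\<close> or inside \<open>D\<close>, those in \<open>C\<close> must match exactly
  what \<open>P\<close> leaves uncovered in \<open>C\<close>. This lets the odd and the even numbers be treated alike.
\<close>

lemma matchings_part:
  assumes M: "M \<in> matchings S" and P: "P \<subseteq> M" "P \<inter> Pow C = {}"
    and cover: "M \<subseteq> P \<union> Pow C \<union> Pow D" and CD: "C \<inter> D = {}" "C \<subseteq> S"
  shows "M \<inter> Pow C \<in> matchings (C - \<Union>P)"
proof -
  have U: "\<Union>M = S" and dj: "disjoint M" and M': "{} \<notin> M" "\<forall>e\<in>M. card e = 2"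
    using M by (auto simp: matchings_def partition_on_def)
  have "\<Union>(M \<inter> Pow C) = C - \<Union>P"
  proof (intro equalityI subsetI)
    fix x assume "x \<in> \<Union>(M \<inter> Pow C)"
    then obtain e where e: "e \<in> M" "e \<subseteq> C" "x \<in> e" by blast
    have "x \<notin> f" if "f \<in> P" for f
    proof -
      have "f \<in> M" "f \<noteq> e" using that P e by blast+
      then show ?thesis using disjointD[OF dj, of e f] e by blast
    qed
    then show "x \<in> C - \<Union>P" using e by blast
  next
    fix x assume x: "x \<in> C - \<Union>P"
    then obtain e where "e \<in> M" "x \<in> e" using U CD(2) by blast
    then show "x \<in> \<Union>(M \<inter> Pow C)" using x cover CD(1) by blast
  qed
  moreover have "disjoint (M \<inter> Pow C)" using dj by (auto simp: disjoint_def)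
  ultimately show ?thesis using M' by (simp add: matchings_def partition_on_def)
qed

fun matching_count :: "nat \<Rightarrow> nat" where
  "matching_count 0 = 1"
| "matching_count (Suc 0) = 0"
| "matching_count (Suc (Suc m)) = Suc m * matching_count m"

lemma card_matchings: "finite S \<Longrightarrow> card (matchings S) = matching_count (card S)"
proof (induction "card S" arbitrary: S rule: matching_count.induct)
  case 1
  then show ?case by (auto simp: matchings_empty)
next
  case 2
  then obtain x where "S = {x}" by (metis One_nat_def card_1_singletonE)
  then show ?case using card_matchings_insert[of "{}" x] by simp
next
  case (3 m)
  from 3(2) obtain x T where S: "S = insert x T" "x \<notin> T" "card T = Suc m"
    by (metis card_Suc_eq)
  have "finite T" using S \<open>finite S\<close> by auto
  have "card (matchings (T - {y})) = matching_count m" if "y \<in> T" for y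
    using 3(1)[of "T - {y}"] that S \<open>finite T\<close> by simp
  then show ?case
    using card_matchings_insert[OF \<open>finite T\<close> S(2)] S \<open>finite T\<close> 3(2)[symmetric] by simp
qed

section \<open>Odd-to-even matches as rook placements\<close>

definition odd_to_even_pairs :: "nat \<Rightarrow> nat set set" where
  "odd_to_even_pairs n = {{i, j} |i j. odd i \<and> even j \<and> i < j \<and> j \<le> 2 * n}"

definition placements :: "nat \<Rightarrow> nat set set set" where
  "placements n = {P. P \<subseteq> odd_to_even_pairs n \<and> disjoint P}"

definition odds :: "nat \<Rightarrow> nat set" where "odds n = {i \<in> {1..2 * n}. odd i}"
definition evens :: "nat \<Rightarrow> nat set" where "evens n = {i \<in> {1..2 * n}. even i}"

lemma odds_Suc: "odds (Suc n) = insert (2 * n + 1) (odds n)"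
  by (auto simp: odds_def) (presburger+)?

lemma evens_Suc: "evens (Suc n) = insert (2 * n + 2) (evens n)"
  by (auto simp: evens_def) (presburger+)?

lemma finite_odds [simp]: "finite (odds n)" and finite_evens [simp]: "finite (evens n)"
  by (auto simp: odds_def evens_def)

lemma card_odds [simp]: "card (odds n) = n"
proof (induction n)
  case (Suc n)
  have "2 * n + 1 \<notin> odds n" by (simp add: odds_def)
  then show ?case using Suc by (simp add: odds_Suc)
qed (simp add: odds_def)

lemma card_evens [simp]: "card (evens n) = n"
proof (induction n)
  case (Suc n)
  have "2 * n + 2 \<notin> evens n" by (simp add: evens_def)
  then show ?case using Suc by (simp add: evens_Suc)
qed (simp add: evens_def)

lemma odds_Un_evens: "odds n \<union> evens n = {1..2 * n}"
  and odds_Int_evens: "odds n \<inter> evens n = {}"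
  by (auto simp: odds_def evens_def)

lemma odd_to_even_pairs_cases:
  assumes "e \<in> odd_to_even_pairs n"
  obtains i j where "e = {i, j}" "i < j" "i \<in> odds n" "j \<in> evens n"
    "e \<inter> odds n = {i}" "e \<inter> evens n = {j}"
proof -
  from assms obtain i j where "e = {i, j}" "odd i" "even j" "i < j" "j \<le> 2 * n"
    by (auto simp: odd_to_even_pairs_def)
  moreover from this have "i \<ge> 1" by (cases i) auto
  ultimately show thesis by (intro that[of i j]) (auto simp: odds_def evens_def)
qed

lemma odd_to_even_pairI:
  assumes "i \<in> odds n" "j \<in> evens n" "i < j"
  shows "{i, j} \<in> odd_to_even_pairs n"
  using assms by (auto simp: odd_to_even_pairs_def odds_def evens_def)

lemma finite_odd_to_even: "finite (odd_to_even_pairs n)"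
  by (rule finite_subset[of _ "Pow (odds n \<union> evens n)"]) (auto elim!: odd_to_even_pairs_cases)

lemma placement_is_matching:
  assumes "P \<in> placements n"
  shows "P \<in> matchings (\<Union>P)"
proof -
  have "card e = 2" if "e \<in> P" for e
  proof -
    have "e \<in> odd_to_even_pairs n" using that assms by (auto simp: placements_def)
    then show ?thesis by (auto elim!: odd_to_even_pairs_cases)
  qed
  moreover from this have "{} \<notin> P" by force
  ultimately show ?thesis
    using assms by (simp add: matchings_def partition_on_def placements_def)
qed

lemma finite_placements: "finite (placements n)"
  by (rule finite_subset[of _ "Pow (odd_to_even_pairs n)"])
    (auto simp: placements_def finite_odd_to_even)

lemma finite_placement: "P \<in> placements n \<Longrightarrow> finite P"
  using finite_odd_to_even by (auto simp: placements_def intro: finite_subset)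

text \<open>Applied to the odd and to the even numbers, of which each edge of a placement contains exactly one.\<close>

lemma card_covered:
  assumes P: "P \<in> placements n"
    and one: "\<And>e. e \<in> odd_to_even_pairs n \<Longrightarrow> card (e \<inter> A) = 1"
  shows "card (A \<inter> \<Union>P) = card P"
proof -
  have dj: "disjoint P" and sub: "P \<subseteq> odd_to_even_pairs n" using P by (auto simp: placements_def)
  have "A \<inter> \<Union>P = (\<Union>e\<in>P. e \<inter> A)" by auto
  also have "card \<dots> = (\<Sum>e\<in>P. card (e \<inter> A))"
  proof (rule card_UN_disjoint)
    show "\<forall>e\<in>P. finite (e \<inter> A)"
      using sub by (auto elim!: odd_to_even_pairs_cases)
    show "\<forall>e\<in>P. \<forall>f\<in>P. e \<noteq> f \<longrightarrow> (e \<inter> A) \<inter> (f \<inter> A) = {}"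
      using dj by (auto simp: disjoint_def)
  qed (use P finite_placement in auto)
  also have "\<dots> = card P" using sub one by (simp add: subset_iff)
  finally show ?thesis .
qed

lemma card_free:
  assumes P: "P \<in> placements n"
  shows "card P \<le> n" "card (odds n - \<Union>P) = n - card P" "card (evens n - \<Union>P) = n - card P"
proof -
  have o: "card (odds n \<inter> \<Union>P) = card P"
    by (rule card_covered[OF P]) (auto elim!: odd_to_even_pairs_cases)
  have e: "card (evens n \<inter> \<Union>P) = card P"
    by (rule card_covered[OF P]) (auto elim!: odd_to_even_pairs_cases)
  show "card P \<le> n" using card_mono[of "odds n" "odds n \<inter> \<Union>P"] o by auto
  show "card (odds n - \<Union>P) = n - card P" "card (evens n - \<Union>P) = n - card P"
    using card_Diff_subset_Int[of "odds n" "\<Union>P"] card_Diff_subset_Int[of "evens n" "\<Union>P"] o e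
    by auto
qed

lemma placements_0: "placements 0 = {{}}"
  by (auto simp: placements_def odd_to_even_pairs_def disjoint_def)

lemma odd_to_even_pairs_Suc:
  "odd_to_even_pairs (Suc n) = odd_to_even_pairs n \<union> (\<lambda>i. {i, 2 * n + 2}) ` odds (Suc n)"
proof (intro equalityI subsetI)
  fix e assume "e \<in> odd_to_even_pairs (Suc n)"
  then obtain i j where *: "e = {i, j}" "i < j" "i \<in> odds (Suc n)" "j \<in> evens (Suc n)"
    by (auto elim: odd_to_even_pairs_cases)
  show "e \<in> odd_to_even_pairs n \<union> (\<lambda>i. {i, 2 * n + 2}) ` odds (Suc n)"
  proof (cases "j = 2 * n + 2")
    case False
    then have j: "j \<in> evens n" using * by (auto simp: evens_Suc)
    then have "i \<in> odds n" using * by (auto simp: odds_def evens_def)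
    then show ?thesis using * j odd_to_even_pairI by blast
  qed (use * in auto)
next
  fix e assume e: "e \<in> odd_to_even_pairs n \<union> (\<lambda>i. {i, 2 * n + 2}) ` odds (Suc n)"
  show "e \<in> odd_to_even_pairs (Suc n)"
  proof (cases "e \<in> odd_to_even_pairs n")
    case True
    then obtain i j where "e = {i, j}" "i < j" "i \<in> odds n" "j \<in> evens n"
      by (auto elim: odd_to_even_pairs_cases)
    then show ?thesis by (simp add: odd_to_even_pairI odds_Suc evens_Suc)
  next
    case False
    then obtain i where "e = {i, 2 * n + 2}" "i \<in> odds (Suc n)" using e by auto
    then show ?thesis by (auto intro!: odd_to_even_pairI simp: odds_def evens_def)
  qed
qed

text \<open>
  The number \<open>2 * n + 1\<close> can only be paired with \<open>2 * n + 2\<close>, because its partner must be larger. So a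
  placement of size \<open>n + 1\<close> is determined by a placement of size \<open>n\<close> and by the partner \<open>i\<close> of
  \<open>2 * n + 2\<close>, if there is one; this partner may be any odd number that is still free.
\<close>

lemma placements_Suc:
  "placements (Suc n) = placements n \<union>
     (\<Union>P\<in>placements n. (\<lambda>i. insert {i, 2 * n + 2} P) ` (odds (Suc n) - \<Union>P))"
  (is "_ = _ \<union> ?B")
proof (intro equalityI subsetI)
  fix Q assume Q: "Q \<in> placements (Suc n)"
  then have dj: "disjoint Q" and sub: "Q \<subseteq> odd_to_even_pairs (Suc n)" by (auto simp: placements_def)
  show "Q \<in> placements n \<union> ?B"
  proof (cases "Q \<subseteq> odd_to_even_pairs n")
    case True
    then show ?thesis using dj by (auto simp: placements_def)
  next
    case False
    then obtain i where i: "{i, 2 * n + 2} \<in> Q" "i \<in> odds (Suc n)"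
      using sub unfolding odd_to_even_pairs_Suc by blast
    let ?P = "Q - {{i, 2 * n + 2}}"
    have apart: "e \<inter> {i, 2 * n + 2} = {}" if "e \<in> ?P" for e
      using that disjointD[OF dj _ i(1)] by simp
    have "?P \<subseteq> odd_to_even_pairs n"
    proof
      fix e assume e: "e \<in> ?P"
      then have "2 * n + 2 \<notin> e" using apart[OF e] by simp
      moreover have "e \<in> odd_to_even_pairs (Suc n)" using e sub by auto
      ultimately show "e \<in> odd_to_even_pairs n" unfolding odd_to_even_pairs_Suc by auto
    qed
    moreover have "disjoint ?P" using dj by (auto simp: disjoint_def)
    ultimately have "?P \<in> placements n" by (simp add: placements_def)
    moreover have "i \<in> odds (Suc n) - \<Union>?P"
    proof -
      have "i \<notin> e" if "e \<in> ?P" for e using apart[OF that] by simp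
      then show ?thesis using i(2) by blast
    qed
    moreover have "Q = insert {i, 2 * n + 2} ?P" using i by auto
    ultimately show ?thesis by blast
  qed
next
  fix Q assume "Q \<in> placements n \<union> ?B"
  then show "Q \<in> placements (Suc n)"
  proof
    assume "Q \<in> ?B"
    then obtain P i where P: "P \<in> placements n" and i: "i \<in> odds (Suc n)" "i \<notin> \<Union>P"
      and Q: "Q = insert {i, 2 * n + 2} P" by blast
    have "2 * n + 2 \<notin> \<Union>P"
      using P by (force simp: placements_def odd_to_even_pairs_def)
    then have "\<forall>e\<in>P. e \<inter> {i, 2 * n + 2} = {}" using i by blast
    then have "disjoint Q" using P unfolding Q placements_def disjoint_def by blast
    moreover have "Q \<subseteq> odd_to_even_pairs (Suc n)"
      using P i unfolding Q odd_to_even_pairs_Suc placements_def by blast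
    ultimately show ?thesis by (simp add: placements_def)
  qed (auto simp: placements_def odd_to_even_pairs_Suc)
qed

definition placement_sum :: "nat \<Rightarrow> (nat \<Rightarrow> nat) \<Rightarrow> nat" where
  "placement_sum n g = (\<Sum>P\<in>placements n. g (n - card P))"

text \<open>
  A placement with \<open>m\<close> free odd numbers extends either to one with \<open>m + 1\<close> of them, when \<open>2 * n + 2\<close>
  stays free, or in \<open>m + 1\<close> ways to one that again has \<open>m\<close>. Passing this step to the summand \<open>g\<close>
  gives the adjoint form of the recurrence of the Stirling numbers \<open>S (n + 1, m + 1)\<close>.
\<close>

definition extend :: "(nat \<Rightarrow> nat) \<Rightarrow> nat \<Rightarrow> nat" where
  "extend g m = g (Suc m) + Suc m * g m"

lemma placement_sum_Suc: "placement_sum (Suc n) g = placement_sum n (extend g)"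
proof -
  let ?v = "2 * n + 2"
  let ?ext = "\<lambda>P. (\<lambda>i. insert {i, ?v} P) ` (odds (Suc n) - \<Union>P)"
  have new: "?v \<notin> e" if "P \<in> placements n" "e \<in> P" for P e
    using that by (force simp: placements_def odd_to_even_pairs_def)
  \<comment> \<open>The smaller placement is recovered by deleting the edge at \<open>2 * n + 2\<close>, so extensions of
    different placements are different.\<close>
  have without: "{e \<in> Q. ?v \<notin> e} = P" if "P \<in> placements n" "Q \<in> ?ext P" for P Q
    using new[OF that(1)] that(2) by auto
  have inj: "inj_on (\<lambda>i. insert {i, ?v} P) (odds (Suc n) - \<Union>P)" if P: "P \<in> placements n" for P
  proof (rule inj_onI)
    fix i k assume ik: "insert {i, ?v} P = insert {k, ?v} P"
      "i \<in> odds (Suc n) - \<Union>P"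
    have "{i, ?v} \<notin> P" using new[OF P] by blast
    then have "{i, ?v} = {k, ?v}" using ik by blast
    then show "i = k" by (auto simp: doubleton_eq_iff)
  qed
  have free: "card (odds (Suc n) - \<Union>P) = Suc (n - card P)" if P: "P \<in> placements n" for P
  proof -
    have "2 * n + 1 \<notin> \<Union>P"
      using P by (force simp: placements_def odd_to_even_pairs_def)
    then have "odds (Suc n) - \<Union>P = insert (2 * n + 1) (odds n - \<Union>P)"
      by (auto simp: odds_Suc)
    moreover have "2 * n + 1 \<notin> odds n" by (simp add: odds_def)
    ultimately show ?thesis using card_free(2)[OF P] by simp
  qed
  have ext: "(\<Sum>Q\<in>?ext P. g (Suc n - card Q)) = Suc (n - card P) * g (n - card P)"
    if P: "P \<in> placements n" for P
  proof -
    have "card Q = Suc (card P)" if "Q \<in> ?ext P" for Q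
      using that new[OF P] finite_placement[OF P] by (auto simp: card_insert_if)
    then have "(\<Sum>Q\<in>?ext P. g (Suc n - card Q)) = (\<Sum>Q\<in>?ext P. g (n - card P))"
      by (intro sum.cong) auto
    also have "\<dots> = card (?ext P) * g (n - card P)" by simp
    also have "card (?ext P) = Suc (n - card P)" using card_image[OF inj[OF P]] free[OF P] by simp
    finally show ?thesis .
  qed
  have "placement_sum (Suc n) g = (\<Sum>P\<in>placements n. g (Suc n - card P)) +
      (\<Sum>Q\<in>(\<Union>P\<in>placements n. ?ext P). g (Suc n - card Q))"
    unfolding placement_sum_def placements_Suc
  proof (rule sum.union_disjoint)
    show "placements n \<inter> (\<Union>P\<in>placements n. ?ext P) = {}"
      using new by blast
  qed (auto simp: finite_placements)
  also have "(\<Sum>Q\<in>(\<Union>P\<in>placements n. ?ext P). g (Suc n - card Q)) =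
      (\<Sum>P\<in>placements n. \<Sum>Q\<in>?ext P. g (Suc n - card Q))"
  proof (rule sum.UNION_disjoint)
    show "\<forall>P\<in>placements n. \<forall>P'\<in>placements n. P \<noteq> P' \<longrightarrow> ?ext P \<inter> ?ext P' = {}"
    proof (intro ballI impI equals0I)
      fix P P' Q
      assume "P \<in> placements n" "P' \<in> placements n" "P \<noteq> P'" "Q \<in> ?ext P \<inter> ?ext P'"
      then show False using without[of P Q] without[of P' Q] by blast
    qed
  qed (auto simp: finite_placements)
  also have "\<dots> = (\<Sum>P\<in>placements n. Suc (n - card P) * g (n - card P))"
    by (intro sum.cong refl ext)
  also have "(\<Sum>P\<in>placements n. g (Suc n - card P)) = (\<Sum>P\<in>placements n. g (Suc (n - card P)))"
    by (intro sum.cong refl) (simp add: Suc_diff_le card_free(1))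
  finally show ?thesis
    by (simp only: placement_sum_def extend_def sum.distrib)
qed

lemma placement_sum_add:
  "placement_sum n (\<lambda>m. f m + g m) = placement_sum n f + placement_sum n g"
  by (simp add: placement_sum_def sum.distrib)

section \<open>Splitting a matching by parity\<close>

definition allowed_matchings :: "nat \<Rightarrow> nat set set set" where
  "allowed_matchings n = {M. perfect_matching n M \<and> \<not> (\<exists>e\<in>M. even_to_odd e)}"

lemma allowed_matchings_iff:
  "M \<in> allowed_matchings n \<longleftrightarrow>
     M \<in> matchings {1..2 * n} \<and> M \<subseteq> odd_to_even_pairs n \<union> Pow (odds n) \<union> Pow (evens n)"
proof (cases "M \<in> matchings {1..2 * n}")
  case True
  have "\<not> even_to_odd e \<longleftrightarrow> e \<in> odd_to_even_pairs n \<union> Pow (odds n) \<union> Pow (evens n)"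
    if e: "e \<in> M" for e
  proof -
    have "card e = 2" "e \<subseteq> {1..2 * n}"
      using True e by (auto simp: matchings_def partition_on_def)
    then obtain i j where ij: "e = {i, j}" "i < j" "i \<in> {1..2 * n}" "j \<in> {1..2 * n}"
      by (auto simp: card_2_iff) (metis insert_commute linorder_neqE_nat)
    have "even_to_odd e \<longleftrightarrow> even i \<and> odd j"
      using ij by (auto simp: even_to_odd_def doubleton_eq_iff)
    moreover have "e \<in> odd_to_even_pairs n \<longleftrightarrow> odd i \<and> even j"
      using ij by (auto simp: odd_to_even_pairs_def doubleton_eq_iff)
    ultimately show ?thesis
      using ij by (auto simp: odds_def evens_def)
  qed
  then show ?thesis using True
    by (auto simp: allowed_matchings_def perfect_matching_def matchings_def)
qed (auto simp: allowed_matchings_def perfect_matching_def matchings_def)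

text \<open>
  Once its odd-to-even pairs are fixed, a matching decomposes freely into a matching of the uncovered
  odd numbers and one of the uncovered even numbers: no edge within one parity class is even-to-odd.
\<close>

lemma card_fibre:
  assumes P: "P \<in> placements n"
  shows "card {M \<in> allowed_matchings n. M \<inter> odd_to_even_pairs n = P} =
    card (matchings (odds n - \<Union>P)) * card (matchings (evens n - \<Union>P))"
proof -
  let ?A = "matchings (odds n - \<Union>P)" and ?B = "matchings (evens n - \<Union>P)"
  let ?F = "{M \<in> allowed_matchings n. M \<inter> odd_to_even_pairs n = P}"
  let ?join = "\<lambda>(A, B). P \<union> A \<union> B"
  let ?split = "\<lambda>M. (M \<inter> Pow (odds n), M \<inter> Pow (evens n))"
  have sub: "P \<subseteq> odd_to_even_pairs n" using P by (simp add: placements_def)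
  have PM: "P \<in> matchings (\<Union>P)" by (rule placement_is_matching[OF P])
  have mixed: "\<not> e \<subseteq> odds n" "\<not> e \<subseteq> evens n" if "e \<in> odd_to_even_pairs n" for e
    using that odds_Int_evens[of n] by (auto elim!: odd_to_even_pairs_cases)
  have UP: "\<Union>P \<subseteq> {1..2 * n}"
    using sub odds_Un_evens[of n] by (auto elim!: odd_to_even_pairs_cases)
  have apart: "\<not> (e \<subseteq> odds n \<and> e \<subseteq> evens n)" if "e \<noteq> {}" for e
    using that odds_Int_evens[of n] by blast
  have parts: "e \<noteq> {} \<and> e \<subseteq> odds n" if "A \<in> ?A" "e \<in> A" for A e
    using matchings_edge[OF that] by auto
  have parts': "e \<noteq> {} \<and> e \<subseteq> evens n" if "B \<in> ?B" "e \<in> B" for B e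
    using matchings_edge[OF that] by auto
  have join_in: "?join x \<in> ?F" and split_join: "?split (?join x) = x" if x: "x \<in> ?A \<times> ?B" for x
  proof -
    obtain A B where AB: "x = (A, B)" "A \<in> ?A" "B \<in> ?B" using x by auto
    have "P \<union> A \<union> B \<in> matchings (\<Union>P \<union> (odds n - \<Union>P) \<union> (evens n - \<Union>P))"
      using odds_Int_evens[of n] by (intro matchings_Un PM AB) auto
    also have "\<Union>P \<union> (odds n - \<Union>P) \<union> (evens n - \<Union>P) = {1..2 * n}"
      using UP odds_Un_evens[of n] by auto
    finally have "P \<union> A \<union> B \<in> allowed_matchings n"
      using parts[OF AB(2)] parts'[OF AB(3)] sub by (auto simp: allowed_matchings_iff)
    moreover have "A \<inter> odd_to_even_pairs n = {}" "B \<inter> odd_to_even_pairs n = {}"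
      using mixed parts[OF AB(2)] parts'[OF AB(3)] by blast+
    ultimately show "?join x \<in> ?F" using sub AB(1) by auto
    have "P \<inter> Pow (odds n) = {}" "P \<inter> Pow (evens n) = {}" using mixed sub by auto
    moreover have "A \<inter> Pow (odds n) = A" "B \<inter> Pow (evens n) = B"
      using parts[OF AB(2)] parts'[OF AB(3)] by auto
    moreover have "e \<notin> Pow (evens n)" if "e \<in> A" for e
      using parts[OF AB(2) that] apart[of e] by simp
    then have "A \<inter> Pow (evens n) = {}" by blast
    moreover have "e \<notin> Pow (odds n)" if "e \<in> B" for e
      using parts'[OF AB(3) that] apart[of e] by simp
    then have "B \<inter> Pow (odds n) = {}" by blast
    ultimately show "?split (?join x) = x" by (simp add: AB(1) Int_Un_distrib2)
  qed
  have join_split: "?join (?split M) = M" and split_in: "?split M \<in> ?A \<times> ?B" if M: "M \<in> ?F" for M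
  proof -
    have MM: "M \<in> matchings {1..2 * n}" and MP: "P = M \<inter> odd_to_even_pairs n"
      and cover: "M \<subseteq> P \<union> Pow (odds n) \<union> Pow (evens n)"
      using M by (auto simp: allowed_matchings_iff)
    show "?join (?split M) = M" using cover MP by auto
    have "P \<inter> Pow (odds n) = {}" "P \<inter> Pow (evens n) = {}" using mixed sub by auto
    moreover have "P \<subseteq> M" "odds n \<subseteq> {1..2 * n}" "evens n \<subseteq> {1..2 * n}"
        "evens n \<inter> odds n = {}" "M \<subseteq> P \<union> Pow (evens n) \<union> Pow (odds n)"
      using MP cover odds_Un_evens[of n] odds_Int_evens[of n] by auto
    ultimately have "M \<inter> Pow (odds n) \<in> ?A" "M \<inter> Pow (evens n) \<in> ?B"
      using matchings_part[OF MM, of P "odds n" "evens n"]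
        matchings_part[OF MM, of P "evens n" "odds n"] cover odds_Int_evens[of n] by simp_all
    then show "?split M \<in> ?A \<times> ?B" by simp
  qed
  have "bij_betw ?join (?A \<times> ?B) ?F"
  proof (rule bij_betw_byWitness[where f' = ?split])
    show "\<forall>x\<in>?A \<times> ?B. ?split (?join x) = x" by (intro ballI split_join)
    show "\<forall>M\<in>?F. ?join (?split M) = M" by (intro ballI join_split)
    show "?join ` (?A \<times> ?B) \<subseteq> ?F" by (intro image_subsetI join_in)
    show "?split ` ?F \<subseteq> ?A \<times> ?B" by (intro image_subsetI split_in)
  qed
  then have "card (?A \<times> ?B) = card ?F" by (rule bij_betw_same_card)
  then show ?thesis by (simp add: card_cartesian_product)
qed

definition weight :: "nat \<Rightarrow> nat" where
  "weight m = (matching_count m)\<^sup>2"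

lemma a_eq_placement_sum: "a n = placement_sum n weight"
proof -
  have fin: "finite (allowed_matchings n)"
    by (rule finite_subset[OF _ finite_matchings[of "{1..2 * n}"]]) (auto simp: allowed_matchings_iff)
  have "allowed_matchings n = (\<Union>P\<in>placements n. {M \<in> allowed_matchings n. M \<inter> odd_to_even_pairs n = P})"
  proof -
    have "M \<inter> odd_to_even_pairs n \<in> placements n" if "M \<in> allowed_matchings n" for M
      using that by (simp add: allowed_matchings_iff placements_def matchings_def partition_on_def disjoint_def)
    then show ?thesis by blast
  qed
  moreover have "a n = card (allowed_matchings n)" by (simp add: a_def allowed_matchings_def)
  ultimately have "a n = card (\<Union>P\<in>placements n. {M \<in> allowed_matchings n. M \<inter> odd_to_even_pairs n = P})"
    by simp
  also have "\<dots> = (\<Sum>P\<in>placements n. card {M \<in> allowed_matchings n. M \<inter> odd_to_even_pairs n = P})"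
    by (rule card_UN_disjoint) (use fin finite_placements in auto)
  also have "\<dots> = (\<Sum>P\<in>placements n. weight (n - card P))"
    by (intro sum.cong refl)
      (simp add: card_fibre card_matchings card_free weight_def power2_eq_square)
  finally show ?thesis by (simp add: placement_sum_def)
qed

section \<open>The binomial transform and the recurrence\<close>

text \<open>
  On generating functions, multiplication by \<open>exp x = 1 + u\<close> turns the sum of \<open>g m * u ^ m / m!\<close> into the
  series with these coefficients. For \<open>m = 0\<close> the truncated \<open>m - 1\<close> is harmless, since the term
  carries the factor \<open>m\<close>.
\<close>

definition binomial_adjoint :: "(nat \<Rightarrow> nat) \<Rightarrow> nat \<Rightarrow> nat" where
  "binomial_adjoint g m = g m + m * g (m - 1)"

text \<open>This is the product rule \<open>(exp x * F)' = exp x * F + exp x * F'\<close>.\<close>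

lemma extend_binomial_adjoint: "extend (binomial_adjoint g) = (\<lambda>m. binomial_adjoint g m + binomial_adjoint (extend g) m)"
proof
  fix m show "extend (binomial_adjoint g) m = binomial_adjoint g m + binomial_adjoint (extend g) m"
    by (cases m) (simp_all add: extend_def binomial_adjoint_def algebra_simps)
qed

text \<open>
  By Pascal's rule the binomial transform of a sequence at \<open>n + 1\<close> is the sum of those of the sequence
  and of its successor sequence at \<open>n\<close>. The product rule above is the same statement for the right-hand
  side, so the induction on \<open>n\<close> has to let \<open>g\<close> vary.
\<close>

lemma sum_binomial_placement_sum:
  "(\<Sum>j\<le>n. (n choose j) * placement_sum j g) = placement_sum n (binomial_adjoint g)"
proof (induction n arbitrary: g)
  case 0
  then show ?case by (simp add: placement_sum_def placements_0 binomial_adjoint_def)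
next
  case (Suc n)
  have "(\<Sum>j\<le>Suc n. (Suc n choose j) * placement_sum j g) =
      placement_sum 0 g + (\<Sum>j\<le>n. (n choose Suc j) * placement_sum (Suc j) g)
      + (\<Sum>j\<le>n. (n choose j) * placement_sum (Suc j) g)"
    by (simp add: sum.atMost_Suc_shift algebra_simps sum.distrib del: sum.atMost_Suc)
  also have "placement_sum 0 g + (\<Sum>j\<le>n. (n choose Suc j) * placement_sum (Suc j) g) =
      (\<Sum>j\<le>Suc n. (n choose j) * placement_sum j g)"
    by (simp add: sum.atMost_Suc_shift del: sum.atMost_Suc)
  also have "\<dots> = (\<Sum>j\<le>n. (n choose j) * placement_sum j g)" by simp
  also have "\<dots> + (\<Sum>j\<le>n. (n choose j) * placement_sum (Suc j) g) =
      placement_sum n (binomial_adjoint g) + placement_sum n (binomial_adjoint (extend g))"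
    by (simp add: Suc placement_sum_Suc)
  also have "\<dots> = placement_sum (Suc n) (binomial_adjoint g)"
    by (simp add: placement_sum_Suc extend_binomial_adjoint placement_sum_add)
  finally show ?case .
qed

lemma weight_Suc: "weight (Suc m) = m\<^sup>2 * weight (m - 1)"
  by (cases m) (simp_all add: weight_def power_mult_distrib del: mult_Suc)

text \<open>
  This is \<open>2 * A' = A + exp x * A'\<close> for the generating function \<open>A\<close> of the sequence \<open>a\<close>. All terms
  cancel except \<open>weight (m + 1)\<close> on the left and \<open>m\<^sup>2 * weight (m - 1)\<close> on the right.
\<close>

lemma weight_functional_equation:
  "extend weight m + extend weight m = weight m + binomial_adjoint (extend weight) m"
proof (cases m)
  case 0
  then show ?thesis using weight_Suc[of 0] by (simp add: extend_def binomial_adjoint_def)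
next
  case (Suc k)
  have "weight (Suc (Suc k)) = (Suc k)\<^sup>2 * weight k" using weight_Suc[of "Suc k"] by simp
  then show ?thesis by (simp add: Suc extend_def binomial_adjoint_def power2_eq_square algebra_simps)
qed

theorem mainTheorem9:
  fixes n :: nat
  assumes "n \<ge> 1"
  shows "a n = a (n - 1) + (\<Sum>i = 1..n - 1. a i * ((n - 1) choose (i - 1)))"
proof -
  obtain k where n: "n = Suc k" using assms by (cases n) auto
  have "a n + a n = placement_sum k (\<lambda>m. extend weight m + extend weight m)"
    by (simp add: n a_eq_placement_sum placement_sum_Suc placement_sum_add)
  also have "\<dots> = a k + (\<Sum>j\<le>k. (k choose j) * a (Suc j))"
    by (simp add: weight_functional_equation placement_sum_add a_eq_placement_sum
        placement_sum_Suc sum_binomial_placement_sum)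
  \<comment> \<open>The last term of the binomial sum is \<open>a n\<close> itself and cancels one of the two copies on the left.\<close>
  also have "(\<Sum>j\<le>k. (k choose j) * a (Suc j)) = (\<Sum>j<k. (k choose j) * a (Suc j)) + a n"
    by (simp add: n lessThan_Suc_atMost[symmetric])
  also have "(\<Sum>j<k. (k choose j) * a (Suc j)) = (\<Sum>i = 1..k. a i * (k choose (i - 1)))"
    by (rule sum.reindex_bij_witness[of _ "\<lambda>i. i - 1" Suc]) auto
  finally show ?thesis by (simp add: n)
qed

end
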